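(* Let $(X,J)$ be an almost complex manifold, $E$ a complex vector bundle over $X$ with a bundle almost complex structure $\mathcal J$, and $\bar\partial_{\mathcal J}$ the pseudoholomorphic structure on $E$ determined by $\mathcal J$. For any smooth section $s\in\Gamma(X,E)$, $\bar\partial_{\mathcal J}s=0$ if and only if $s$ is $(J,\mathcal J)$-holomorphic.
   Context: Let $\pi:E\to X$ be a complex vector bundle over an almost complex manifold $(X,J)$. A bundle almost complex structure on $E$ is an almost complex structure $\mathcal J$ on the total space of $E$ such that (i) $\pi$ is $(\mathcal J,J)$-holomorphic; (ii) $\mathcal J$ induces the standard complex structure (multiplication by $i$) on each fiber; (iii) the fiberwise addition $E\times_X E\to E$ and the fiberwise scalar multiplication $\mathbb C\times E\to E$ are pseudoholomorphic. A pseudoholomorphic structure on $E$ is a differential operator $\bar\partial_E:\Gamma(X,E)\to\Gamma(X,(T^*X)^{0,1}\otimes E)$ with $\bar\partial_E(fs)=\bar\partial f\otimes s+f\bar\partial_E s$. The pseudoholomorphic structure $\bar\partial_{\mathcal J}$ determined by $\mathcal J$: for $s\in\Gamma(X,E)$ put $d''s=\frac12(ds+\mathcal J\circ ds\circ J):TX\to TE$. It takes values in the vertical tangent bundle $V(E)=\ker d\pi\cong\pi^*E$; composing with the natural bundle map $\pi^*E\to E$ covering $\pi$ gives a bundle homomorphism $TX\to E$ over $\mathrm{id}_X$; $\bar\partial_{\mathcal J}s\in\Gamma(X,(T^*X)^{0,1}\otimes E)$ is the restriction to $(TX)^{0,1}$ of its complex-linear extension to $TX\otimes\mathbb C$. A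 section $s:X\to E$ is $(J,\mathcal J)$-holomorphic if $ds\circ J=\mathcal J\circ ds$. *)

theory Defs
  imports "HOL-Analysis.Analysis"
begin

section \<open>Smooth maps between normed spaces\<close>

text \<open>For an open subset \<open>S\<close> of a finite-dimensional space, the only case used below, \<open>C_on k S f\<close>
  is the usual notion of a \<open>C\<^sup>k\<close> map.\<close>

primrec C_on :: "nat \<Rightarrow> 'a::real_normed_vector set \<Rightarrow> ('a \<Rightarrow> 'b::real_normed_vector) \<Rightarrow> bool" where
  "C_on 0 S f \<longleftrightarrow> continuous_on S f"
| "C_on (Suc k) S f \<longleftrightarrow>
     (\<forall>x\<in>S. f differentiable (at x)) \<and> (\<forall>u. C_on k S (\<lambda>x. frechet_derivative f (at x) u))"

definition smooth_on :: "'a::real_normed_vector set \<Rightarrow> ('a \<Rightarrow> 'b::real_normed_vector) \<Rightarrow> bool" where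
  "smooth_on S f \<longleftrightarrow> (\<forall>k. C_on k S f)"


section \<open>Smooth manifolds\<close>

text \<open>A chart is its domain together with its coordinate map. The values of the map outside the
  domain are irrelevant. The model space \<open>'m\<close> is a finite-dimensional real normed space; unlike
  \<open>euclidean_space\<close>, this does not exclude dimension \<open>0\<close>.\<close>

type_synonym ('a, 'm) chart = "'a set \<times> ('a \<Rightarrow> 'm)"

record ('a, 'm) manifold =
  mtop :: "'a topology"
  atlas :: "('a, 'm) chart set"

abbreviation points :: "('a, 'm) manifold \<Rightarrow> 'a set" where
  "points M \<equiv> topspace (mtop M)"

definition chart_inv :: "('a, 'm) chart \<Rightarrow> 'm \<Rightarrow> 'a" where
  "chart_inv c = inv_into (fst c) (snd c)"

definition charts_at :: "('a, 'm) manifold \<Rightarrow> 'a \<Rightarrow> ('a, 'm) chart set" where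
  "charts_at M p = {c \<in> atlas M. p \<in> fst c}"

definition smooth_manifold :: "('a, 'm::real_normed_vector) manifold \<Rightarrow> bool" where
  "smooth_manifold M \<longleftrightarrow>
     (\<exists>B::'m set. finite B \<and> span B = UNIV) \<and>
     Hausdorff_space (mtop M) \<and> second_countable (mtop M) \<and>
     (\<Union>c\<in>atlas M. fst c) = points M \<and>
     (\<forall>c\<in>atlas M. openin (mtop M) (fst c) \<and> open (snd c ` fst c) \<and>
        homeomorphic_map (subtopology (mtop M) (fst c)) (top_of_set (snd c ` fst c)) (snd c)) \<and>
     (\<forall>c\<in>atlas M. \<forall>d\<in>atlas M. smooth_on (snd c ` (fst c \<inter> fst d)) (snd d \<circ> chart_inv c))"

definition smooth_map ::
    "('a, 'm::real_normed_vector) manifold \<Rightarrow> ('b, 'n::real_normed_vector) manifold \<Rightarrow> ('a \<Rightarrow> 'b) \<Rightarrow> bool" where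
  "smooth_map M N F \<longleftrightarrow>
     continuous_map (mtop M) (mtop N) F \<and>
     (\<forall>c\<in>atlas M. \<forall>d\<in>atlas N.
        smooth_on (snd c ` (fst c \<inter> F -` fst d)) (snd d \<circ> F \<circ> chart_inv c))"


section \<open>Tangent vectors\<close>

text \<open>A tangent vector at \<open>p\<close> is a family of coordinate vectors, one for each chart of the atlas
  around \<open>p\<close>, that transform into each other under the derivatives of the transition maps. At all
  other charts the family is \<open>0\<close> by convention, so that the vector space operations of
  \<open>tangent_space M p\<close> are the pointwise ones.\<close>

type_synonym ('a, 'm) tvec = "('a, 'm) chart \<Rightarrow> 'm"

definition tangent_space :: "('a, 'm::real_normed_vector) manifold \<Rightarrow> 'a \<Rightarrow> ('a, 'm) tvec set" where
  "tangent_space M p =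
     {v. (\<forall>c. c \<notin> charts_at M p \<longrightarrow> v c = 0) \<and>
         (\<forall>c\<in>charts_at M p. \<forall>d\<in>charts_at M p.
            v d = frechet_derivative (snd d \<circ> chart_inv c) (at (snd c p)) (v c))}"

definition chart_vector ::
    "('a, 'm::real_normed_vector) manifold \<Rightarrow> ('a, 'm) chart \<Rightarrow> 'a \<Rightarrow> 'm \<Rightarrow> ('a, 'm) tvec" where
  "chart_vector M c p u =
     (\<lambda>d. if d \<in> charts_at M p
          then frechet_derivative (snd d \<circ> chart_inv c) (at (snd c p)) u else 0)"

text \<open>The differential \<open>dF\<^sub>p\<close>; it does not depend on the chart selected at \<open>p\<close>.\<close>

definition tangent_map ::
    "('a, 'm::real_normed_vector) manifold \<Rightarrow> ('b, 'n::real_normed_vector) manifold \<Rightarrow>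
     ('a \<Rightarrow> 'b) \<Rightarrow> 'a \<Rightarrow> ('a, 'm) tvec \<Rightarrow> ('b, 'n) tvec" where
  "tangent_map M N F p v =
     (let c = (SOME c. c \<in> charts_at M p) in
      (\<lambda>d. if d \<in> charts_at N (F p)
           then frechet_derivative (snd d \<circ> F \<circ> chart_inv c) (at (snd c p)) (v c) else 0))"

definition velocity ::
    "('a, 'm::real_normed_vector) manifold \<Rightarrow> (real \<Rightarrow> 'a) \<Rightarrow> real \<Rightarrow> ('a, 'm) tvec" where
  "velocity M \<gamma> t =
     (\<lambda>c. if c \<in> charts_at M (\<gamma> t) then vector_derivative (snd c \<circ> \<gamma>) (at t) else 0)"


section \<open>Almost complex structures\<close>

text \<open>A field of endomorphisms of the tangent spaces. The values \<open>J p v\<close> with \<open>p\<close> not a point or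
  \<open>v\<close> not a tangent vector at \<open>p\<close> are irrelevant.\<close>

type_synonym ('a, 'm) endo_field = "'a \<Rightarrow> ('a, 'm) tvec \<Rightarrow> ('a, 'm) tvec"

text \<open>The last clause says that in each chart the matrix of \<open>J\<close> depends smoothly on the point.\<close>

definition almost_complex_structure ::
    "('a, 'm::real_normed_vector) manifold \<Rightarrow> ('a, 'm) endo_field \<Rightarrow> bool" where
  "almost_complex_structure M J \<longleftrightarrow>
     (\<forall>p\<in>points M. \<forall>v\<in>tangent_space M p.
        J p v \<in> tangent_space M p \<and>
        (\<forall>w\<in>tangent_space M p. J p (\<lambda>c. v c + w c) = (\<lambda>c. J p v c + J p w c)) \<and>
        (\<forall>r::real. J p (\<lambda>c. r *\<^sub>R v c) = (\<lambda>c. r *\<^sub>R J p v c)) \<and>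
        J p (J p v) = (\<lambda>c. - v c)) \<and>
     (\<forall>c\<in>atlas M. \<forall>u.
        smooth_on (snd c ` fst c)
          (\<lambda>x. J (chart_inv c x) (chart_vector M c (chart_inv c x) u) c))"

definition almost_complex_manifold ::
    "('a, 'm::real_normed_vector) manifold \<Rightarrow> ('a, 'm) endo_field \<Rightarrow> bool" where
  "almost_complex_manifold M J \<longleftrightarrow> smooth_manifold M \<and> almost_complex_structure M J"

text \<open>\<open>F\<close> is a \<open>(J, K)\<close>-holomorphic map: it is smooth and \<open>dF \<circ> J = K \<circ> dF\<close>.\<close>

definition pseudoholomorphic ::
    "('a, 'm::real_normed_vector) manifold \<Rightarrow> ('a, 'm) endo_field \<Rightarrow>
     ('b, 'n::real_normed_vector) manifold \<Rightarrow> ('b, 'n) endo_field \<Rightarrow> ('a \<Rightarrow> 'b) \<Rightarrow> bool" where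
  "pseudoholomorphic M J N K F \<longleftrightarrow>
     smooth_map M N F \<and>
     (\<forall>p\<in>points M. \<forall>v\<in>tangent_space M p.
        tangent_map M N F p (J p v) = K (F p) (tangent_map M N F p v))"

text \<open>For a manifold \<open>P\<close> with maps \<open>f : P \<rightarrow> M\<close> and \<open>g : P \<rightarrow> N\<close> such that \<open>(df, dg)\<close> embeds
  \<open>T\<^sub>p P\<close> as a \<open>(J \<oplus> K)\<close>-invariant subspace of \<open>T\<^sub>f\<^sub>p M \<oplus> T\<^sub>g\<^sub>p N\<close>: the restriction of
  \<open>J \<oplus> K\<close> to \<open>T P\<close>. It is used for products and fibre products, with the two projections as
  \<open>f\<close> and \<open>g\<close>.\<close>

definition induced_structure ::
    "('p, 'k::real_normed_vector) manifold \<Rightarrow>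
     ('a, 'm::real_normed_vector) manifold \<Rightarrow> ('a, 'm) endo_field \<Rightarrow> ('p \<Rightarrow> 'a) \<Rightarrow>
     ('b, 'n::real_normed_vector) manifold \<Rightarrow> ('b, 'n) endo_field \<Rightarrow> ('p \<Rightarrow> 'b) \<Rightarrow>
     ('p, 'k) endo_field" where
  "induced_structure P M J f N K g =
     (\<lambda>p v. THE w. w \<in> tangent_space P p \<and>
        tangent_map P M f p w = J (f p) (tangent_map P M f p v) \<and>
        tangent_map P N g p w = K (g p) (tangent_map P N g p v))"

definition prod_manifold ::
    "('a, 'm) manifold \<Rightarrow> ('b, 'n) manifold \<Rightarrow> ('a \<times> 'b, 'm \<times> 'n) manifold" where
  "prod_manifold M N =
     \<lparr> mtop = prod_topology (mtop M) (mtop N),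
       atlas = {(fst c \<times> fst d, map_prod (snd c) (snd d)) | c d. c \<in> atlas M \<and> d \<in> atlas N} \<rparr>"

definition prod_structure ::
    "('a, 'm::real_normed_vector) manifold \<Rightarrow> ('a, 'm) endo_field \<Rightarrow>
     ('b, 'n::real_normed_vector) manifold \<Rightarrow> ('b, 'n) endo_field \<Rightarrow> ('a \<times> 'b, 'm \<times> 'n) endo_field" where
  "prod_structure M J N K = induced_structure (prod_manifold M N) M J fst N K snd"

definition complex_plane :: "(complex, complex) manifold" where
  "complex_plane = \<lparr> mtop = euclidean, atlas = {(UNIV, id)} \<rparr>"

definition complex_plane_structure :: "(complex, complex) endo_field" where
  "complex_plane_structure = (\<lambda>z v c. \<i> * v c)"


section \<open>Complex vector bundles\<close>

text \<open>The typical fibre is a finite-dimensional complex vector space, namely the real normed space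
  \<open>'f\<close> with the complex scalar multiplication \<open>model_scale\<close> extending the real one; for rank
  \<open>r \<ge> 1\<close> this is \<open>\<complex>\<^sup>r\<close>, and rank \<open>0\<close> is not excluded. A local trivialization over \<open>U\<close> is
  represented by \<open>U\<close> and the second component \<open>\<Phi>\<close> of the map
  \<open>\<pi>\<^sup>-\<^sup>1(U) \<rightarrow> U \<times> 'f\<close>, \<open>e \<mapsto> (\<pi> e, \<Phi> e)\<close>.\<close>

record ('e, 'a, 'f) vbundle =
  etop :: "'e topology"
  proj :: "'e \<Rightarrow> 'a"
  fzero :: "'a \<Rightarrow> 'e"
  fadd :: "'e \<Rightarrow> 'e \<Rightarrow> 'e"
  fscale :: "complex \<Rightarrow> 'e \<Rightarrow> 'e"
  model_scale :: "complex \<Rightarrow> 'f \<Rightarrow> 'f"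
  trivs :: "('a set \<times> ('e \<Rightarrow> 'f)) set"

definition fibre :: "('e, 'a, 'f) vbundle \<Rightarrow> 'a \<Rightarrow> 'e set" where
  "fibre E x = {e \<in> topspace (etop E). proj E e = x}"

definition part_over :: "('e, 'a, 'f) vbundle \<Rightarrow> 'a set \<Rightarrow> 'e set" where
  "part_over E U = {e \<in> topspace (etop E). proj E e \<in> U}"

text \<open>The total space: a chart \<open>\<phi>\<close> of the base and a trivialization \<open>\<Phi>\<close> give the chart
  \<open>e \<mapsto> (\<phi> (\<pi> e), \<Phi> e)\<close>.\<close>

definition total_space ::
    "('a, 'm) manifold \<Rightarrow> ('e, 'a, 'f) vbundle \<Rightarrow> ('e, 'm \<times> 'f) manifold" where
  "total_space X E =
     \<lparr> mtop = etop E,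
       atlas = {(part_over E (fst c \<inter> fst t), (\<lambda>e. (snd c (proj E e), snd t e))) | c t.
                  c \<in> atlas X \<and> t \<in> trivs E} \<rparr>"

text \<open>The complex vector space axioms on the fibres need no separate mention: every fibre is
  mapped bijectively onto \<open>'f\<close> by a map that respects zero, addition and scalar multiplication.
  Smoothness of the transition functions is part of \<open>smooth_manifold (total_space X E)\<close>.\<close>

definition complex_vector_bundle ::
    "('a, 'm::real_normed_vector) manifold \<Rightarrow> ('e, 'a, 'f::real_normed_vector) vbundle \<Rightarrow> bool" where
  "complex_vector_bundle X E \<longleftrightarrow>
     vector_space (model_scale E) \<and>
     (\<forall>(r::real) w. model_scale E (of_real r) w = r *\<^sub>R w) \<and>
     (\<exists>B::'f set. finite B \<and> span B = UNIV) \<and>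
     continuous_map (etop E) (mtop X) (proj E) \<and>
     (\<Union>t\<in>trivs E. fst t) = points X \<and>
     (\<forall>x\<in>points X.
        fzero E x \<in> fibre E x \<and>
        (\<forall>e\<in>fibre E x. \<forall>e'\<in>fibre E x. fadd E e e' \<in> fibre E x) \<and>
        (\<forall>a. \<forall>e\<in>fibre E x. fscale E a e \<in> fibre E x)) \<and>
     (\<forall>t\<in>trivs E.
        openin (mtop X) (fst t) \<and>
        homeomorphic_map (subtopology (etop E) (part_over E (fst t)))
          (prod_topology (subtopology (mtop X) (fst t)) euclidean) (\<lambda>e. (proj E e, snd t e)) \<and>
        (\<forall>x\<in>fst t.
           snd t (fzero E x) = 0 \<and>
           (\<forall>e\<in>fibre E x. \<forall>e'\<in>fibre E x. snd t (fadd E e e') = snd t e + snd t e') \<and>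
           (\<forall>a. \<forall>e\<in>fibre E x. snd t (fscale E a e) = model_scale E a (snd t e)))) \<and>
     smooth_manifold (total_space X E)"

definition smooth_section ::
    "('a, 'm::real_normed_vector) manifold \<Rightarrow> ('e, 'a, 'f::real_normed_vector) vbundle \<Rightarrow> ('a \<Rightarrow> 'e) \<Rightarrow> bool" where
  "smooth_section X E s \<longleftrightarrow>
     smooth_map X (total_space X E) s \<and> (\<forall>x\<in>points X. proj E (s x) = x)"

text \<open>The fibre product \<open>E \<times>\<^sub>X E\<close>, a submanifold of \<open>E \<times> E\<close>, with the charts
  \<open>(e, e') \<mapsto> (\<phi> (\<pi> e), \<Phi> e, \<Phi> e')\<close>.\<close>

definition fibre_product ::
    "('a, 'm) manifold \<Rightarrow> ('e, 'a, 'f) vbundle \<Rightarrow> ('e \<times> 'e, 'm \<times> 'f \<times> 'f) manifold" where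
  "fibre_product X E =
     \<lparr> mtop = subtopology (prod_topology (etop E) (etop E)) {(e, e'). proj E e = proj E e'},
       atlas = {({(e, e'). e \<in> part_over E (fst c \<inter> fst t) \<and> e' \<in> fibre E (proj E e)},
                 (\<lambda>(e, e'). (snd c (proj E e), snd t e, snd t e'))) | c t.
                  c \<in> atlas X \<and> t \<in> trivs E} \<rparr>"

text \<open>The canonical isomorphism \<open>\<pi>\<^sup>*E \<cong> V(E) = ker d\<pi>\<close> over \<open>e\<close> sends \<open>w \<in> E\<^bsub>\<pi>(e)\<^esub>\<close> to the velocity
  at \<open>0\<close> of the curve \<open>t \<mapsto> e + t w\<close>. The map \<open>vertical_part\<close> is the composition of its inverse
  with \<open>\<pi>\<^sup>*E \<rightarrow> E\<close>, and is only meaningful on \<open>vertical_space\<close>.\<close>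

definition vertical_space ::
    "('a, 'm::real_normed_vector) manifold \<Rightarrow> ('e, 'a, 'f::real_normed_vector) vbundle \<Rightarrow> 'e \<Rightarrow>
     ('e, 'm \<times> 'f) tvec set" where
  "vertical_space X E e =
     {\<nu> \<in> tangent_space (total_space X E) e. tangent_map (total_space X E) X (proj E) e \<nu> = (\<lambda>c. 0)}"

definition vertical_lift ::
    "('a, 'm::real_normed_vector) manifold \<Rightarrow> ('e, 'a, 'f::real_normed_vector) vbundle \<Rightarrow> 'e \<Rightarrow> 'e \<Rightarrow>
     ('e, 'm \<times> 'f) tvec" where
  "vertical_lift X E e w =
     velocity (total_space X E) (\<lambda>t. fadd E e (fscale E (of_real t) w)) 0"

definition vertical_part ::
    "('a, 'm::real_normed_vector) manifold \<Rightarrow> ('e, 'a, 'f::real_normed_vector) vbundle \<Rightarrow> 'e \<Rightarrow>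
     ('e, 'm \<times> 'f) tvec \<Rightarrow> 'e" where
  "vertical_part X E e \<nu> = inv_into (fibre E (proj E e)) (vertical_lift X E e) \<nu>"


section \<open>Bundle almost complex structures\<close>

text \<open>The last four clauses: the projection is holomorphic; on each fibre, whose tangent spaces are
  identified with the fibre itself by \<open>vertical_lift\<close>, the structure is multiplication by \<open>\<i>\<close>;
  fibrewise addition and scalar multiplication are pseudoholomorphic.\<close>

definition bundle_almost_complex_structure ::
    "('a, 'm::real_normed_vector) manifold \<Rightarrow> ('a, 'm) endo_field \<Rightarrow>
     ('e, 'a, 'f::real_normed_vector) vbundle \<Rightarrow> ('e, 'm \<times> 'f) endo_field \<Rightarrow> bool" where
  "bundle_almost_complex_structure X J E \<J> \<longleftrightarrow>
     (let T = total_space X E; P = fibre_product X E in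
      almost_complex_structure T \<J> \<and>
      pseudoholomorphic T \<J> X J (proj E) \<and>
      (\<forall>e\<in>topspace (etop E). \<forall>w\<in>fibre E (proj E e).
         \<J> e (vertical_lift X E e w) = vertical_lift X E e (fscale E \<i> w)) \<and>
      pseudoholomorphic P (induced_structure P T \<J> fst T \<J> snd) T \<J> (\<lambda>(e, e'). fadd E e e') \<and>
      pseudoholomorphic (prod_manifold complex_plane T)
        (prod_structure complex_plane complex_plane_structure T \<J>) T \<J> (\<lambda>(a, e). fscale E a e))"


section \<open>The operator determined by a bundle almost complex structure\<close>

text \<open>A pair \<open>(u, v)\<close> of tangent vectors at \<open>p\<close> stands for the element \<open>u + \<i>v\<close> of
  \<open>T\<^sub>p X \<otimes> \<complex>\<close>; thus \<open>\<i> (u, v) = (-v, u)\<close>. The space \<open>T\<^sub>p X\<^sup>0\<^sup>,\<^sup>1\<close> is the \<open>-\<i>\<close>-eigenspace of the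
  complex-linear extension \<open>(u, v) \<mapsto> (J u, J v)\<close> of \<open>J\<close>.\<close>

definition tangent01 ::
    "('a, 'm::real_normed_vector) manifold \<Rightarrow> ('a, 'm) endo_field \<Rightarrow> 'a \<Rightarrow>
     (('a, 'm) tvec \<times> ('a, 'm) tvec) set" where
  "tangent01 X J p =
     {(u, v). u \<in> tangent_space X p \<and> v \<in> tangent_space X p \<and> (J p u, J p v) = (v, \<lambda>c. - u c)}"

text \<open>\<open>d''s = (ds + \<J> \<circ> ds \<circ> J) / 2\<close>.\<close>

definition d'' ::
    "('a, 'm::real_normed_vector) manifold \<Rightarrow> ('a, 'm) endo_field \<Rightarrow>
     ('e, 'a, 'f::real_normed_vector) vbundle \<Rightarrow> ('e, 'm \<times> 'f) endo_field \<Rightarrow> ('a \<Rightarrow> 'e) \<Rightarrow>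
     'a \<Rightarrow> ('a, 'm) tvec \<Rightarrow> ('e, 'm \<times> 'f) tvec" where
  "d'' X J E \<J> s p v =
     (let ds = tangent_map X (total_space X E) s p in
      (\<lambda>c. (1/2) *\<^sub>R (ds v c + \<J> (s p) (ds (J p v)) c)))"

text \<open>At \<open>p\<close>, the complex-linear extension \<open>u + \<i>v \<mapsto> \<alpha> u + \<i> \<alpha> v\<close> of the homomorphism
  \<open>\<alpha> : T\<^sub>p X \<rightarrow> E\<^sub>p\<close> obtained from \<open>d''s\<close>, restricted to \<open>T\<^sub>p X\<^sup>0\<^sup>,\<^sup>1\<close>.\<close>

definition dbar ::
    "('a, 'm::real_normed_vector) manifold \<Rightarrow> ('a, 'm) endo_field \<Rightarrow>
     ('e, 'a, 'f::real_normed_vector) vbundle \<Rightarrow> ('e, 'm \<times> 'f) endo_field \<Rightarrow> ('a \<Rightarrow> 'e) \<Rightarrow>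
     'a \<Rightarrow> ('a, 'm) tvec \<times> ('a, 'm) tvec \<Rightarrow> 'e" where
  "dbar X J E \<J> s p =
     (let \<alpha> = (\<lambda>v. vertical_part X E (s p) (d'' X J E \<J> s p v)) in
      restrict (\<lambda>(u, v). fadd E (\<alpha> u) (fscale E \<i> (\<alpha> v))) (tangent01 X J p))"

text \<open>Vanishing of a section of \<open>(T\<^sup>*X)\<^sup>0\<^sup>,\<^sup>1 \<otimes> E\<close>, that is, of a family of maps
  \<open>T\<^sub>p X\<^sup>0\<^sup>,\<^sup>1 \<rightarrow> E\<^sub>p\<close>.\<close>

definition vanishes01 ::
    "('a, 'm::real_normed_vector) manifold \<Rightarrow> ('a, 'm) endo_field \<Rightarrow> ('e, 'a, 'f) vbundle \<Rightarrow>
     ('a \<Rightarrow> ('a, 'm) tvec \<times> ('a, 'm) tvec \<Rightarrow> 'e) \<Rightarrow> bool" where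
  "vanishes01 X J E \<beta> \<longleftrightarrow> (\<forall>p\<in>points X. \<forall>\<zeta>\<in>tangent01 X J p. \<beta> p \<zeta> = fzero E p)"

end

theory Submission
  imports Defs
begin

text \<open>For \<open>v\<close> tangent to \<open>X\<close> the vector \<open>d''s v\<close> is vertical and \<open>d''s (J v) = - \<J> (d''s v)\<close>. Under the
  identification of vertical vectors with the fibre, on which \<open>\<J>\<close> is multiplication by \<open>\<i>\<close>, this says
  \<open>\<alpha> (J v) = - \<i> \<alpha> v\<close> for the homomorphism \<open>\<alpha> : TX \<rightarrow> E\<close> obtained from \<open>d''s\<close>. The elements of
  \<open>TX\<^sup>0\<^sup>,\<^sup>1\<close> are \<open>v + \<i> J v\<close>, and the complex-linear extension of \<open>\<alpha>\<close> takes this element to \<open>2 \<alpha> v\<close>.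
  So it vanishes iff \<open>d''s = 0\<close>, which after applying \<open>\<J>\<close> is the Cauchy--Riemann equation.\<close>

section \<open>Charts\<close>

lemma charts_atD: "c \<in> charts_at M p \<Longrightarrow> c \<in> atlas M \<and> p \<in> fst c"
  by (simp add: charts_at_def)

lemma charts_at_nonempty:
  assumes "smooth_manifold M" "p \<in> points M"
  shows "\<exists>c. c \<in> charts_at M p"
  using assms unfolding smooth_manifold_def charts_at_def by blast

lemma openin_chart_domain: "smooth_manifold M \<Longrightarrow> c \<in> atlas M \<Longrightarrow> openin (mtop M) (fst c)"
  unfolding smooth_manifold_def by blast

lemma inj_on_chart:
  assumes "smooth_manifold M" "c \<in> atlas M"
  shows "inj_on (snd c) (fst c)"
proof -
  have "homeomorphic_map (subtopology (mtop M) (fst c)) (top_of_set (snd c ` fst c)) (snd c)"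
    using assms unfolding smooth_manifold_def by blast
  then have "inj_on (snd c) (topspace (subtopology (mtop M) (fst c)))"
    by (simp only: homeomorphic_eq_everything_map)
  then show ?thesis
    using openin_subset[OF openin_chart_domain[OF assms]] by (simp add: Int_absorb1)
qed

lemma chart_inv_snd [simp]:
  assumes "smooth_manifold M" "c \<in> atlas M" "p \<in> fst c"
  shows "chart_inv c (snd c p) = p"
  using inj_on_chart[OF assms(1,2)] assms(3) by (simp add: chart_inv_def)

text \<open>The chart is a homeomorphism onto its image, so it carries \<open>U\<close> to a
  relatively open set; openness in the model space follows because the whole coordinate image is
  open.\<close>

lemma open_chart_image:
  assumes M: "smooth_manifold M" "c \<in> atlas M" and U: "openin (mtop M) U" "U \<subseteq> fst c"
  shows "open (snd c ` U)"
proof -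
  have h: "homeomorphic_map (subtopology (mtop M) (fst c)) (top_of_set (snd c ` fst c)) (snd c)"
    and o: "open (snd c ` fst c)"
    using M unfolding smooth_manifold_def by blast+
  have "openin (subtopology (mtop M) (fst c)) U"
    using U by (simp add: openin_open_subtopology[OF openin_chart_domain[OF M]])
  then have "openin (top_of_set (snd c ` fst c)) (snd c ` U)"
    using homeomorphic_map_openness_eq[OF h] by blast
  then show ?thesis
    using o openin_open_trans by blast
qed

text \<open>Translates neighbourhoods of \<open>p\<close> into coordinate neighbourhoods, so that
  derivatives can be compared for coordinate expressions that agree only locally.\<close>

lemma eventually_chart_inv:
  assumes M: "smooth_manifold M" and c: "c \<in> charts_at M p" and U: "openin (mtop M) U" "p \<in> U"
  shows "\<forall>\<^sub>F x in at (snd c p). chart_inv c x \<in> U"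
proof -
  have c': "c \<in> atlas M" "p \<in> fst c"
    using charts_atD[OF c] by auto
  have "open (snd c ` (U \<inter> fst c))"
    using open_chart_image[OF M c'(1)] openin_chart_domain[OF M c'(1)] U(1) by blast
  moreover have "snd c p \<in> snd c ` (U \<inter> fst c)"
    using c' U by blast
  ultimately have "\<forall>\<^sub>F x in at (snd c p). x \<in> snd c ` (U \<inter> fst c)"
    by (rule eventually_at_in_open')
  then show ?thesis
    by eventually_elim (use M c' in auto)
qed

section \<open>Differentials\<close>

text \<open>With \<open>id\<close> for \<open>F\<close> this is the derivative of a transition map,
  so changes of chart become instances of the chain rule for smooth maps.\<close>

abbreviation chart_deriv ::
    "('a, 'm::real_normed_vector) chart \<Rightarrow> ('b, 'n::real_normed_vector) chart \<Rightarrow> ('a \<Rightarrow> 'b) \<Rightarrow> 'a \<Rightarrow> 'm \<Rightarrow> 'n" where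
  "chart_deriv c d F p \<equiv> frechet_derivative (snd d \<circ> F \<circ> chart_inv c) (at (snd c p))"

text \<open>In charts the identity is a transition map, and transition maps of a smooth manifold are
  smooth.\<close>

lemma smooth_map_id:
  assumes "smooth_manifold M"
  shows "smooth_map M M id"
  using assms unfolding smooth_manifold_def smooth_map_def by simp

lemma smooth_map_points:
  assumes "smooth_map M N F" "p \<in> points M"
  shows "F p \<in> points N"
  using assms continuous_map_funspace unfolding smooth_map_def by fast

lemma smooth_map_has_derivative:
  assumes F: "smooth_map M N F" and c: "c \<in> charts_at M p" and d: "d \<in> charts_at N (F p)"
  shows "((snd d \<circ> F \<circ> chart_inv c) has_derivative chart_deriv c d F p) (at (snd c p))"
proof -
  have "C_on (Suc 0) (snd c ` (fst c \<inter> F -` fst d)) (snd d \<circ> F \<circ> chart_inv c)"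
    using F charts_atD[OF c] charts_atD[OF d] unfolding smooth_map_def smooth_on_def by blast
  moreover have "snd c p \<in> snd c ` (fst c \<inter> F -` fst d)"
    using charts_atD[OF c] charts_atD[OF d] by blast
  ultimately have "(snd d \<circ> F \<circ> chart_inv c) differentiable at (snd c p)"
    unfolding C_on.simps by blast
  then show ?thesis
    by (simp add: frechet_derivative_works)
qed

lemma linear_chart_deriv:
  assumes "smooth_map M N F" "c \<in> charts_at M p" "d \<in> charts_at N (F p)"
  shows "linear (chart_deriv c d F p)"
  using smooth_map_has_derivative[OF assms] by (rule has_derivative_linear)

lemma eventually_smooth_map_in_chart:
  assumes M: "smooth_manifold M" and N: "smooth_manifold N" and F: "smooth_map M N F"
    and c: "c \<in> charts_at M p" and d: "d \<in> charts_at N (F p)"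
  shows "\<forall>\<^sub>F x in at (snd c p). F (chart_inv c x) \<in> fst d"
proof -
  have cont: "continuous_map (mtop M) (mtop N) F"
    using F unfolding smooth_map_def by blast
  have "openin (mtop M) {q \<in> points M. F q \<in> fst d}"
    using cont openin_chart_domain[OF N] charts_atD[OF d] openin_continuous_map_preimage by blast
  moreover have "p \<in> {q \<in> points M. F q \<in> fst d}"
    using charts_atD[OF c] charts_atD[OF d] openin_subset[OF openin_chart_domain[OF M]] by blast
  ultimately have "\<forall>\<^sub>F x in at (snd c p). chart_inv c x \<in> {q \<in> points M. F q \<in> fst d}"
    by (rule eventually_chart_inv[OF M c])
  then show ?thesis
    by eventually_elim simp
qed

lemma chart_deriv_compose:
  assumes M: "smooth_manifold M" and N: "smooth_manifold N"
    and F: "smooth_map M N F" and G: "smooth_map N L G"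
    and c: "c \<in> charts_at M p" and d: "d \<in> charts_at N (F p)" and e: "e \<in> charts_at L (G (F p))"
  shows "chart_deriv c e (G \<circ> F) p u = chart_deriv d e G (F p) (chart_deriv c d F p u)"
proof -
  let ?f = "snd d \<circ> F \<circ> chart_inv c" and ?g = "snd e \<circ> G \<circ> chart_inv d"
  have fx: "?f (snd c p) = snd d (F p)"
    using M charts_atD[OF c] by auto
  have "(?g \<circ> ?f has_derivative chart_deriv d e G (F p) \<circ> chart_deriv c d F p) (at (snd c p))"
    using diff_chain_at[OF smooth_map_has_derivative[OF F c d], of ?g]
      smooth_map_has_derivative[OF G d e] unfolding fx by blast
  \<comment> \<open>The inner factors \<open>chart_inv d\<close> and \<open>snd d\<close> cancel
    only where \<open>F\<close> lands in the domain of \<open>d\<close>, which happens near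
    \<open>p\<close> by continuity of \<open>F\<close>.\<close>
  moreover have "\<forall>\<^sub>F x in at (snd c p). (?g \<circ> ?f) x = (snd e \<circ> (G \<circ> F) \<circ> chart_inv c) x"
    using eventually_smooth_map_in_chart[OF M N F c d]
    by eventually_elim (use N charts_atD[OF d] in auto)
  moreover have "(?g \<circ> ?f) (snd c p) = (snd e \<circ> (G \<circ> F) \<circ> chart_inv c) (snd c p)"
    using M N charts_atD[OF c] charts_atD[OF d] by auto
  ultimately have "(snd e \<circ> (G \<circ> F) \<circ> chart_inv c has_derivative
      chart_deriv d e G (F p) \<circ> chart_deriv c d F p) (at (snd c p))"
    by (rule has_derivative_transform_eventually) auto
  from frechet_derivative_at[OF this] show ?thesis
    by (metis comp_apply)
qed

section \<open>Tangent vectors in coordinates\<close>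

lemma tangent_space_iff:
  "v \<in> tangent_space M p \<longleftrightarrow>
     (\<forall>c. c \<notin> charts_at M p \<longrightarrow> v c = 0) \<and>
     (\<forall>c\<in>charts_at M p. \<forall>d\<in>charts_at M p. v d = chart_deriv c d id p (v c))"
  by (simp add: tangent_space_def)

lemma tangent_space_outside: "v \<in> tangent_space M p \<Longrightarrow> c \<notin> charts_at M p \<Longrightarrow> v c = 0"
  unfolding tangent_space_iff by blast

lemma tangent_space_chart:
  "v \<in> tangent_space M p \<Longrightarrow> c \<in> charts_at M p \<Longrightarrow> d \<in> charts_at M p \<Longrightarrow> v d = chart_deriv c d id p (v c)"
  unfolding tangent_space_iff by blast

text \<open>One coordinate vector determines the family: the transition derivatives give it in the
  other charts around \<open>p\<close>, and the convention gives 0 elsewhere.\<close>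

lemma tangent_space_eqI:
  assumes v: "v \<in> tangent_space M p" and w: "w \<in> tangent_space M p"
    and c: "c \<in> charts_at M p" and eq: "v c = w c"
  shows "v = w"
proof
  fix d
  show "v d = w d"
  proof (cases "d \<in> charts_at M p")
    case True
    show ?thesis
      by (simp only: tangent_space_chart[OF v c True] tangent_space_chart[OF w c True] eq)
  next
    case False
    show ?thesis
      by (simp only: tangent_space_outside[OF v False] tangent_space_outside[OF w False])
  qed
qed

text \<open>Linearity of the transition derivatives. Special coefficients also yield closure under
  halving and the zero vector.\<close>

lemma tangent_space_linear_combination:
  assumes M: "smooth_manifold M" and v: "v \<in> tangent_space M p" and w: "w \<in> tangent_space M p"
  shows "(\<lambda>c. a *\<^sub>R v c + b *\<^sub>R w c) \<in> tangent_space M p"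
  unfolding tangent_space_iff
proof (intro conjI ballI allI impI)
  fix c
  assume "c \<notin> charts_at M p"
  then show "a *\<^sub>R v c + b *\<^sub>R w c = 0"
    using v w by (simp add: tangent_space_outside)
next
  fix c d
  assume c: "c \<in> charts_at M p" and d: "d \<in> charts_at M p"
  have "linear (chart_deriv c d id p)"
    using linear_chart_deriv[OF smooth_map_id[OF M] c] d by simp
  then have "chart_deriv c d id p (a *\<^sub>R v c + b *\<^sub>R w c) =
      a *\<^sub>R chart_deriv c d id p (v c) + b *\<^sub>R chart_deriv c d id p (w c)"
    by (simp only: linear_add linear_scale)
  moreover have "v d = chart_deriv c d id p (v c)" "w d = chart_deriv c d id p (w c)"
    using v w c d by (blast intro: tangent_space_chart)+
  ultimately show "a *\<^sub>R v d + b *\<^sub>R w d = chart_deriv c d id p (a *\<^sub>R v c + b *\<^sub>R w c)"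
    by simp
qed

section \<open>Differentials as maps of tangent spaces\<close>

text \<open>Independence of the chart chosen by \<open>SOME\<close>: the transition derivative takes
  \<open>v c0\<close> to \<open>v c\<close>, and the chain rule for \<open>F \<circ> id\<close>
  absorbs it.\<close>

lemma tangent_map_chart:
  assumes M: "smooth_manifold M" and F: "smooth_map M N F"
    and c: "c \<in> charts_at M p" and d: "d \<in> charts_at N (F p)" and v: "v \<in> tangent_space M p"
  shows "tangent_map M N F p v d = chart_deriv c d F p (v c)"
proof -
  define c0 where "c0 = (SOME c. c \<in> charts_at M p)"
  have c0: "c0 \<in> charts_at M p"
    unfolding c0_def using c by (rule someI)
  have "v c = chart_deriv c0 c id p (v c0)"
    using v c0 c by (rule tangent_space_chart)
  then have "chart_deriv c d F p (v c) = chart_deriv c0 d (F \<circ> id) p (v c0)"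
    using chart_deriv_compose[OF M M smooth_map_id[OF M] F c0, of c d "v c0"] c d by simp
  then show ?thesis
    using d by (simp add: tangent_map_def c0_def Let_def)
qed

lemma tangent_map_outside: "d \<notin> charts_at N (F p) \<Longrightarrow> tangent_map M N F p v d = 0"
  by (simp add: tangent_map_def Let_def)

text \<open>Compatibility between two charts of \<open>N\<close> is the chain rule for
  \<open>id \<circ> F\<close>.\<close>

lemma tangent_map_in_tangent_space:
  assumes M: "smooth_manifold M" and N: "smooth_manifold N" and F: "smooth_map M N F"
    and p: "p \<in> points M" and v: "v \<in> tangent_space M p"
  shows "tangent_map M N F p v \<in> tangent_space N (F p)"
proof -
  obtain c where c: "c \<in> charts_at M p"
    using charts_at_nonempty[OF M p] by blast
  show ?thesis
    unfolding tangent_space_iff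
  proof (intro conjI ballI allI impI)
    fix d e
    assume d: "d \<in> charts_at N (F p)" and e: "e \<in> charts_at N (F p)"
    then show "tangent_map M N F p v e = chart_deriv d e id (F p) (tangent_map M N F p v d)"
      using chart_deriv_compose[OF M N F smooth_map_id[OF N] c d, of e "v c"]
      by (simp only: tangent_map_chart[OF M F c _ v] id_apply id_comp)
  qed (rule tangent_map_outside)
qed

lemma tangent_map_linear_combination:
  assumes M: "smooth_manifold M" and F: "smooth_map M N F" and p: "p \<in> points M"
    and v: "v \<in> tangent_space M p" and w: "w \<in> tangent_space M p"
  shows "tangent_map M N F p (\<lambda>c. a *\<^sub>R v c + b *\<^sub>R w c) =
    (\<lambda>d. a *\<^sub>R tangent_map M N F p v d + b *\<^sub>R tangent_map M N F p w d)"
proof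
  fix d
  obtain c where c: "c \<in> charts_at M p"
    using charts_at_nonempty[OF M p] by blast
  show "tangent_map M N F p (\<lambda>c. a *\<^sub>R v c + b *\<^sub>R w c) d =
    a *\<^sub>R tangent_map M N F p v d + b *\<^sub>R tangent_map M N F p w d"
  proof (cases "d \<in> charts_at N (F p)")
    case True
    then show ?thesis
      by (simp only: tangent_map_chart[OF M F c True] v w tangent_space_linear_combination[OF M v w]
          linear_add[OF linear_chart_deriv[OF F c True]] linear_scale[OF linear_chart_deriv[OF F c True]])
  qed (simp add: tangent_map_outside)
qed

lemma tangent_map_uminus:
  assumes "smooth_manifold M" "smooth_map M N F" "p \<in> points M" "v \<in> tangent_space M p"
  shows "tangent_map M N F p (\<lambda>c. - v c) = (\<lambda>d. - tangent_map M N F p v d)"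
  using tangent_map_linear_combination[OF assms assms(4), of "-1" 0] by simp

text \<open>The chain rule for \<open>G \<circ> F\<close>, which is the identity. It will be applied
  to a section and the bundle projection.\<close>

lemma tangent_map_section:
  assumes M: "smooth_manifold M" and N: "smooth_manifold N"
    and F: "smooth_map M N F" and G: "smooth_map N M G"
    and GF: "\<And>q. q \<in> points M \<Longrightarrow> G (F q) = q" and p: "p \<in> points M" and v: "v \<in> tangent_space M p"
  shows "tangent_map N M G (F p) (tangent_map M N F p v) = v"
proof
  fix e
  let ?w = "tangent_map M N F p v"
  obtain c where c: "c \<in> charts_at M p"
    using charts_at_nonempty[OF M p] by blast
  obtain d where d: "d \<in> charts_at N (F p)"
    using charts_at_nonempty[OF N smooth_map_points[OF F p]] by blast
  show "tangent_map N M G (F p) ?w e = v e"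
  proof (cases "e \<in> charts_at M p")
    case True
    then have e: "e \<in> charts_at M (G (F p))"
      using GF[OF p] by simp
    have id_deriv: "(snd e \<circ> id \<circ> chart_inv c has_derivative chart_deriv c e id p) (at (snd c p))"
      using smooth_map_has_derivative[OF smooth_map_id[OF M] c] True by simp
    \<comment> \<open>\<open>G \<circ> F\<close> is known to be the identity only on
      \<open>points M\<close>; since this set is open, the coordinate expressions still agree near
      \<open>snd c p\<close>, which fixes the derivative.\<close>
    have "openin (mtop M) (points M)"
      by simp
    then have "\<forall>\<^sub>F x in at (snd c p). chart_inv c x \<in> points M"
      using eventually_chart_inv[OF M c] p by blast
    then have "\<forall>\<^sub>F x in at (snd c p). (snd e \<circ> id \<circ> chart_inv c) x = (snd e \<circ> (G \<circ> F) \<circ> chart_inv c) x"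
      by eventually_elim (simp add: GF)
    moreover have "(snd e \<circ> id \<circ> chart_inv c) (snd c p) = (snd e \<circ> (G \<circ> F) \<circ> chart_inv c) (snd c p)"
      using M charts_atD[OF c] GF[OF p] by simp
    ultimately have "(snd e \<circ> (G \<circ> F) \<circ> chart_inv c has_derivative chart_deriv c e id p) (at (snd c p))"
      by (rule has_derivative_transform_eventually[OF id_deriv]) simp
    from frechet_derivative_at[OF this]
    have "chart_deriv c e (G \<circ> F) p (v c) = chart_deriv c e id p (v c)"
      by metis
    moreover have "\<dots> = v e"
      using tangent_space_chart[OF v c True] by (rule sym)
    moreover have "tangent_map N M G (F p) ?w e = chart_deriv d e G (F p) (?w d)"
      by (rule tangent_map_chart[OF N G d e tangent_map_in_tangent_space[OF M N F p v]])
    ultimately show ?thesis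
      using chart_deriv_compose[OF M N F G c d e] tangent_map_chart[OF M F c d v] by simp
  next
    case False
    then show ?thesis
      using v GF[OF p] by (simp add: tangent_map_outside tangent_space_outside)
  qed
qed


section \<open>Almost complex structures\<close>

lemma almost_complex_structureD:
  assumes "almost_complex_structure M J" "p \<in> points M" "v \<in> tangent_space M p"
  shows "J p v \<in> tangent_space M p"
    and "w \<in> tangent_space M p \<Longrightarrow> J p (\<lambda>c. v c + w c) = (\<lambda>c. J p v c + J p w c)"
    and "J p (\<lambda>c. r *\<^sub>R v c) = (\<lambda>c. r *\<^sub>R J p v c)"
    and "J p (J p v) = (\<lambda>c. - v c)"
  using assms unfolding almost_complex_structure_def by blast+

lemma almost_complex_structure_uminus:
  assumes "almost_complex_structure M J" "p \<in> points M" "v \<in> tangent_space M p"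
  shows "J p (\<lambda>c. - v c) = (\<lambda>c. - J p v c)"
  using almost_complex_structureD(3)[OF assms, of "-1"] by simp

text \<open>The first eigenvector equation is \<open>J p u = v\<close>; the second then follows
  since \<open>J\<close> squares to -1. Thus \<open>u \<mapsto> u + \<i> J u\<close> parametrizes
  the (0,1)-vectors by real tangent vectors.\<close>

lemma tangent01_iff:
  assumes "almost_complex_structure M J" "p \<in> points M"
  shows "(u, v) \<in> tangent01 M J p \<longleftrightarrow> u \<in> tangent_space M p \<and> v = J p u"
  using almost_complex_structureD(1,4)[OF assms] unfolding tangent01_def by auto

section \<open>Vertical tangent vectors\<close>

context
  fixes X :: "('a, 'm::real_normed_vector) manifold" and E :: "('e, 'a, 'f::real_normed_vector) vbundle"
  assumes vb: "complex_vector_bundle X E"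
begin

interpretation vector_space "model_scale E"
  using vb unfolding complex_vector_bundle_def by blast

section \<open>Fibres and local trivializations\<close>

lemma smooth_total_space: "smooth_manifold (total_space X E)"
  using vb unfolding complex_vector_bundle_def by blast

lemma points_total_space: "points (total_space X E) = topspace (etop E)"
  by (simp add: total_space_def)

lemma model_scale_of_real: "model_scale E (of_real r) w = r *\<^sub>R w"
  using vb unfolding complex_vector_bundle_def by blast

lemma proj_points: "e \<in> topspace (etop E) \<Longrightarrow> proj E e \<in> points X"
  using vb continuous_map_funspace unfolding complex_vector_bundle_def by fast

lemma in_fibre_proj: "e \<in> topspace (etop E) \<Longrightarrow> e \<in> fibre E (proj E e)"
  by (simp add: fibre_def)

lemma fibre_ops:
  assumes "x \<in> points X"
  shows "fzero E x \<in> fibre E x"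
    and "e \<in> fibre E x \<Longrightarrow> e' \<in> fibre E x \<Longrightarrow> fadd E e e' \<in> fibre E x"
    and "e \<in> fibre E x \<Longrightarrow> fscale E a e \<in> fibre E x"
  using vb assms unfolding complex_vector_bundle_def by blast+

lemma triv_ops:
  assumes "t \<in> trivs E" "x \<in> fst t"
  shows "snd t (fzero E x) = 0"
    and "e \<in> fibre E x \<Longrightarrow> e' \<in> fibre E x \<Longrightarrow> snd t (fadd E e e') = snd t e + snd t e'"
    and "e \<in> fibre E x \<Longrightarrow> snd t (fscale E a e) = model_scale E a (snd t e)"
  using vb assms unfolding complex_vector_bundle_def by blast+

lemma triv_at_exists:
  assumes "x \<in> points X"
  shows "\<exists>t\<in>trivs E. x \<in> fst t"
  using vb assms unfolding complex_vector_bundle_def by blast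

text \<open>The first component of the trivializing homeomorphism is the projection, so it restricts
  over \<open>x\<close> to a bijection of the fibre with \<open>{x} \<times> UNIV\<close>.\<close>

lemma bij_betw_triv_fibre:
  assumes t: "t \<in> trivs E" and x: "x \<in> fst t"
  shows "bij_betw (snd t) (fibre E x) UNIV"
proof -
  have "homeomorphic_map (subtopology (etop E) (part_over E (fst t)))
      (prod_topology (subtopology (mtop X) (fst t)) euclidean) (\<lambda>e. (proj E e, snd t e))"
    and "fst t \<subseteq> points X"
    using vb t openin_subset unfolding complex_vector_bundle_def by blast+
  then have inj: "inj_on (\<lambda>e. (proj E e, snd t e)) (part_over E (fst t))"
    and surj: "(\<lambda>e. (proj E e, snd t e)) ` part_over E (fst t) = fst t \<times> UNIV"
    unfolding homeomorphic_eq_everything_map by (auto simp: part_over_def Int_absorb1 Int_def)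
  have "inj_on (snd t) (fibre E x)"
    using inj x unfolding inj_on_def fibre_def part_over_def by auto
  moreover have "w \<in> snd t ` fibre E x" for w
  proof -
    have "(x, w) \<in> (\<lambda>e. (proj E e, snd t e)) ` part_over E (fst t)"
      using surj x by blast
    then show ?thesis
      by (auto simp: fibre_def part_over_def)
  qed
  then have "snd t ` fibre E x = UNIV"
    by blast
  ultimately show ?thesis
    unfolding bij_betw_def by blast
qed

text \<open>Transfers identities between elements of a fibre to the model space, where linear
  algebra is available.\<close>

lemma fibre_eqI:
  assumes "t \<in> trivs E" "x \<in> fst t" "w \<in> fibre E x" "w' \<in> fibre E x" "snd t w = snd t w'"
  shows "w = w'"
  using bij_betw_imp_inj_on[OF bij_betw_triv_fibre[OF assms(1,2)]] assms(3-5) by (blast dest: inj_onD)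

section \<open>Charts of the total space\<close>

text \<open>A name for the charts in the atlas of \<open>total_space\<close>, splitting coordinates
  into a base part and a fibre part.\<close>

definition triv_chart :: "('a, 'm) chart \<Rightarrow> 'a set \<times> ('e \<Rightarrow> 'f) \<Rightarrow> ('e, 'm \<times> 'f) chart" where
  "triv_chart c t = (part_over E (fst c \<inter> fst t), \<lambda>e. (snd c (proj E e), snd t e))"

lemma charts_at_total_space:
  "C \<in> charts_at (total_space X E) e \<longleftrightarrow>
    (\<exists>c t. C = triv_chart c t \<and> c \<in> charts_at X (proj E e) \<and> t \<in> trivs E \<and> proj E e \<in> fst t \<and>
       e \<in> topspace (etop E))"
proof -
  have "C \<in> atlas (total_space X E) \<longleftrightarrow> (\<exists>c t. C = triv_chart c t \<and> c \<in> atlas X \<and> t \<in> trivs E)"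
    unfolding total_space_def triv_chart_def by simp
  moreover have "e \<in> fst (triv_chart c t) \<longleftrightarrow> e \<in> topspace (etop E) \<and> proj E e \<in> fst c \<and> proj E e \<in> fst t" for c t
    by (simp add: triv_chart_def part_over_def)
  ultimately show ?thesis
    unfolding charts_at_def by blast
qed

lemma triv_chart_exists:
  assumes X: "smooth_manifold X" and e: "e \<in> topspace (etop E)"
  obtains c t where "triv_chart c t \<in> charts_at (total_space X E) e" "c \<in> charts_at X (proj E e)"
    "t \<in> trivs E" "proj E e \<in> fst t"
proof -
  obtain c where "c \<in> charts_at X (proj E e)"
    using charts_at_nonempty[OF X proj_points[OF e]] by blast
  moreover obtain t where "t \<in> trivs E" "proj E e \<in> fst t"
    using triv_at_exists[OF proj_points[OF e]] by blast
  ultimately show ?thesis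
    using that e unfolding charts_at_total_space by blast
qed

section \<open>Vertical lifts as velocities of lines in the fibres\<close>

lemma line_in_fibre:
  assumes "e \<in> topspace (etop E)" "w \<in> fibre E (proj E e)"
  shows "fadd E e (fscale E a w) \<in> fibre E (proj E e)"
  using assms by (intro fibre_ops proj_points in_fibre_proj)

text \<open>Since \<open>snd t\<close> is linear on the fibre and \<open>of_real r\<close> acts on
  the model as real scaling, the curve is an affine line in coordinates with constant base
  part.\<close>

lemma triv_chart_line:
  assumes e: "e \<in> topspace (etop E)" and w: "w \<in> fibre E (proj E e)"
    and t: "t \<in> trivs E" "proj E e \<in> fst t"
  shows "snd (triv_chart c t) (fadd E e (fscale E (of_real r) w)) =
    snd (triv_chart c t) e + r *\<^sub>R (0, snd t w)"
  using line_in_fibre[OF e w, of "of_real r"] fibre_ops(3)[OF proj_points[OF e] w, of "of_real r"]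
    triv_ops(2)[OF t in_fibre_proj[OF e], of "fscale E (of_real r) w"] triv_ops(3)[OF t w, of "of_real r"]
  by (simp add: triv_chart_def fibre_def model_scale_of_real)

text \<open>Identifies the base point of the velocity in \<open>vertical_lift\<close>, hence the
  charts at which that velocity is not 0 by convention.\<close>

lemma line_at_0:
  assumes e: "e \<in> topspace (etop E)" and w: "w \<in> fibre E (proj E e)"
  shows "fadd E e (fscale E (of_real 0) w) = e"
proof -
  obtain t where t: "t \<in> trivs E" "proj E e \<in> fst t"
    using triv_at_exists[OF proj_points[OF e]] by blast
  have "snd t (fadd E e (fscale E (of_real 0) w)) = snd t e"
    \<comment> \<open>Only the fibre component is compared, so the base chart may be arbitrary,
      hence \<open>undefined\<close>.\<close>
    using triv_chart_line[OF e w t, of undefined 0] by (simp add: triv_chart_def)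
  then show ?thesis
    using fibre_eqI[OF t line_in_fibre[OF e w] in_fibre_proj[OF e]] by blast
qed

lemma has_vector_derivative_triv_chart_line:
  assumes e: "e \<in> topspace (etop E)" and w: "w \<in> fibre E (proj E e)"
    and t: "t \<in> trivs E" "proj E e \<in> fst t"
  shows "((snd (triv_chart c t) \<circ> (\<lambda>r. fadd E e (fscale E (of_real r) w))) has_vector_derivative
    (0, snd t w)) (at 0)"
proof -
  have "((\<lambda>r. snd (triv_chart c t) e + r *\<^sub>R (0, snd t w)) has_vector_derivative (0, snd t w)) (at 0)"
    by (auto intro!: derivative_eq_intros)
  then show ?thesis
    by (simp only: comp_def triv_chart_line[OF e w t])
qed

lemma vertical_lift_outside:
  assumes e: "e \<in> topspace (etop E)" and w: "w \<in> fibre E (proj E e)"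
    and C: "C \<notin> charts_at (total_space X E) e"
  shows "vertical_lift X E e w C = 0"
  using C by (simp only: vertical_lift_def velocity_def line_at_0[OF e w] if_False)

lemma vertical_lift_chart:
  assumes e: "e \<in> topspace (etop E)" and w: "w \<in> fibre E (proj E e)"
    and c: "c \<in> charts_at X (proj E e)" and t: "t \<in> trivs E" "proj E e \<in> fst t"
  shows "vertical_lift X E e w (triv_chart c t) = (0, snd t w)"
proof -
  have "triv_chart c t \<in> charts_at (total_space X E) e"
    using e c t unfolding charts_at_total_space by blast
  then show ?thesis
    by (simp only: vertical_lift_def velocity_def line_at_0[OF e w] if_True
        vector_derivative_at[OF has_vector_derivative_triv_chart_line[OF e w t]])
qed

text \<open>The coordinate curve in \<open>D\<close> is the transition map from \<open>C\<close>
  applied to the coordinate curve in \<open>C\<close>. Differentiating at 0 gives the transformation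
  law, by uniqueness of derivatives.\<close>

lemma vertical_lift_in_tangent_space:
  assumes e: "e \<in> topspace (etop E)" and w: "w \<in> fibre E (proj E e)"
  shows "vertical_lift X E e w \<in> tangent_space (total_space X E) e"
  unfolding tangent_space_iff
proof (intro conjI ballI allI impI)
  let ?T = "total_space X E" and ?\<gamma> = "\<lambda>r. fadd E e (fscale E (of_real r) w)"
  fix C D
  assume C: "C \<in> charts_at ?T e" and D: "D \<in> charts_at ?T e"
  obtain c t where ct: "C = triv_chart c t" "c \<in> charts_at X (proj E e)" "t \<in> trivs E" "proj E e \<in> fst t"
    using C unfolding charts_at_total_space by blast
  obtain d u where du: "D = triv_chart d u" "d \<in> charts_at X (proj E e)" "u \<in> trivs E" "proj E e \<in> fst u"
    using D unfolding charts_at_total_space by blast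
  \<comment> \<open>The line never leaves its fibre, hence stays in the chart domain for every
    \<open>r\<close>, and the two coordinate curves are related globally.\<close>
  have \<gamma>: "?\<gamma> r \<in> fst C" for r
    using line_in_fibre[OF e w, of "of_real r"] charts_atD[OF ct(2)] ct(4)
    by (auto simp: ct(1) triv_chart_def part_over_def fibre_def)
  have "((snd C \<circ> ?\<gamma>) has_vector_derivative (0, snd t w)) (at 0)"
    unfolding ct(1) by (rule has_vector_derivative_triv_chart_line[OF e w ct(3,4)])
  moreover have "((snd D \<circ> id \<circ> chart_inv C) has_derivative chart_deriv C D id e) (at ((snd C \<circ> ?\<gamma>) 0))"
    unfolding comp_apply[of "snd C" ?\<gamma>] line_at_0[OF e w]
    by (rule smooth_map_has_derivative[OF smooth_map_id[OF smooth_total_space] C]) (simp only: id_apply D)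
  ultimately have "((snd D \<circ> id \<circ> chart_inv C) \<circ> (snd C \<circ> ?\<gamma>) has_vector_derivative
      chart_deriv C D id e (0, snd t w)) (at 0)"
    by (rule vector_derivative_diff_chain_within[OF _ has_derivative_at_withinI])
  moreover have "(snd D \<circ> id \<circ> chart_inv C) \<circ> (snd C \<circ> ?\<gamma>) = snd D \<circ> ?\<gamma>"
    using \<gamma> smooth_total_space charts_atD[OF C] by (simp add: fun_eq_iff)
  moreover have "((snd D \<circ> ?\<gamma>) has_vector_derivative (0, snd u w)) (at 0)"
    unfolding du(1) by (rule has_vector_derivative_triv_chart_line[OF e w du(3,4)])
  ultimately have "(0, snd u w) = chart_deriv C D id e (0, snd t w)"
    by (metis vector_derivative_unique_at)
  then show "vertical_lift X E e w D = chart_deriv C D id e (vertical_lift X E e w C)"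
    by (simp only: ct(1) du(1) vertical_lift_chart[OF e w ct(2-4)] vertical_lift_chart[OF e w du(2-4)])
qed (rule vertical_lift_outside[OF e w])

section \<open>Vertical vectors and the fibre\<close>

text \<open>In adapted charts the projection is locally the linear map \<open>fst\<close>, which is
  its own derivative.\<close>

lemma tangent_map_proj:
  assumes X: "smooth_manifold X" and pr: "smooth_map (total_space X E) X (proj E)"
    and C: "triv_chart c t \<in> charts_at (total_space X E) e" and c: "c \<in> charts_at X (proj E e)"
    and v: "v \<in> tangent_space (total_space X E) e"
  shows "tangent_map (total_space X E) X (proj E) e v c = fst (v (triv_chart c t))"
proof -
  let ?T = "total_space X E" and ?C = "triv_chart c t"
  have T: "smooth_manifold ?T"
    by (rule smooth_total_space)
  have "openin (mtop ?T) (fst ?C)"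
    using openin_chart_domain[OF T] charts_atD[OF C] by blast
  then have "\<forall>\<^sub>F x in at (snd ?C e). chart_inv ?C x \<in> fst ?C"
    using eventually_chart_inv[OF T C] charts_atD[OF C] by blast
  \<comment> \<open>On the coordinate image \<open>snd ?C\<close> undoes
    \<open>chart_inv ?C\<close>, so the base coordinate of the point over \<open>x\<close> is
    \<open>fst x\<close>.\<close>
  moreover have "\<forall>\<^sub>F x in at (snd ?C e). x \<in> snd ?C ` fst ?C"
    using open_chart_image[OF T, of ?C "fst ?C"] openin_chart_domain[OF T] charts_atD[OF C]
    by (intro eventually_at_in_open') auto
  ultimately have "\<forall>\<^sub>F x in at (snd ?C e). fst x = (snd c \<circ> proj E \<circ> chart_inv ?C) x"
  proof eventually_elim
    case (elim x)
    then have "snd ?C (chart_inv ?C x) = x"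
      using T charts_atD[OF C] by auto
    then show ?case
      by (simp add: triv_chart_def prod_eq_iff)
  qed
  moreover have "fst (snd ?C e) = (snd c \<circ> proj E \<circ> chart_inv ?C) (snd ?C e)"
  proof -
    have "fst (snd ?C e) = snd c (proj E e)"
      by (simp add: triv_chart_def)
    moreover have "chart_inv ?C (snd ?C e) = e"
      using chart_inv_snd[OF T] charts_atD[OF C] by blast
    ultimately show ?thesis
      by (simp only: comp_apply)
  qed
  ultimately have "((snd c \<circ> proj E \<circ> chart_inv ?C) has_derivative fst) (at (snd ?C e))"
    by (rule has_derivative_transform_eventually[OF bounded_linear_imp_has_derivative[OF bounded_linear_fst]])
      simp
  then have "chart_deriv ?C c (proj E) e = fst"
    by (rule frechet_derivative_at[symmetric])
  then show ?thesis
    by (simp only: tangent_map_chart[OF T pr C c v])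
qed

text \<open>Verticality kills the base coordinate, and the trivialization realizes the fibre
  coordinate as \<open>snd t w\<close>. Agreement in this one chart determines the tangent
  vector.\<close>

lemma vertical_lift_surj:
  assumes X: "smooth_manifold X" and pr: "smooth_map (total_space X E) X (proj E)"
    and e: "e \<in> topspace (etop E)" and v: "v \<in> vertical_space X E e"
  shows "\<exists>w\<in>fibre E (proj E e). vertical_lift X E e w = v"
proof -
  obtain c t where C: "triv_chart c t \<in> charts_at (total_space X E) e"
    and ct: "c \<in> charts_at X (proj E e)" "t \<in> trivs E" "proj E e \<in> fst t"
    using triv_chart_exists[OF X e] by blast
  have vT: "v \<in> tangent_space (total_space X E) e"
    and "tangent_map (total_space X E) X (proj E) e v = (\<lambda>c. 0)"
    using v unfolding vertical_space_def by blast+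
  then have 0: "fst (v (triv_chart c t)) = 0"
    using tangent_map_proj[OF X pr C ct(1) vT] by simp
  have "snd (v (triv_chart c t)) \<in> snd t ` fibre E (proj E e)"
    using bij_betw_triv_fibre[OF ct(2,3)] unfolding bij_betw_def by simp
  then obtain w where w: "w \<in> fibre E (proj E e)" "snd t w = snd (v (triv_chart c t))"
    by force
  have "vertical_lift X E e w (triv_chart c t) = v (triv_chart c t)"
    using vertical_lift_chart[OF e w(1) ct] w(2) 0 by (simp add: prod_eq_iff)
  then show ?thesis
    using tangent_space_eqI[OF vertical_lift_in_tangent_space[OF e w(1)] vT C] w(1) by blast
qed

text \<open>Surjectivity of the lift is what makes the \<open>inv_into\<close> in
  \<open>vertical_part\<close> a right inverse on vertical vectors.\<close>

lemma vertical_part: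
  assumes "smooth_manifold X" "smooth_map (total_space X E) X (proj E)"
    and "e \<in> topspace (etop E)" "v \<in> vertical_space X E e"
  shows "vertical_part X E e v \<in> fibre E (proj E e)"
    and "vertical_lift X E e (vertical_part X E e v) = v"
  using vertical_lift_surj[OF assms]
  unfolding vertical_part_def by (blast intro: inv_into_into f_inv_into_f)+

lemma vertical_lift_eq_0_iff:
  assumes X: "smooth_manifold X" and e: "e \<in> topspace (etop E)" and w: "w \<in> fibre E (proj E e)"
  shows "vertical_lift X E e w = (\<lambda>c. 0) \<longleftrightarrow> w = fzero E (proj E e)"
proof -
  obtain c t where C: "triv_chart c t \<in> charts_at (total_space X E) e"
    and ct: "c \<in> charts_at X (proj E e)" "t \<in> trivs E" "proj E e \<in> fst t"
    using triv_chart_exists[OF X e] by blast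
  have z: "fzero E (proj E e) \<in> fibre E (proj E e)"
    by (rule fibre_ops(1)[OF proj_points[OF e]])
  note lift = vertical_lift_in_tangent_space[OF e w]
  \<comment> \<open>The zero family is the combination with coefficients 0 and 0; its tangency
    permits testing the lift for 0 in a single chart.\<close>
  have "(\<lambda>c. 0) \<in> tangent_space (total_space X E) e"
    using tangent_space_linear_combination[OF smooth_total_space lift lift, of 0 0] by simp
  then have "vertical_lift X E e w = (\<lambda>c. 0) \<longleftrightarrow> vertical_lift X E e w (triv_chart c t) = 0"
    using tangent_space_eqI[OF lift _ C] by metis
  also have "\<dots> \<longleftrightarrow> snd t w = 0"
    by (simp add: vertical_lift_chart[OF e w ct] zero_prod_def)
  also have "\<dots> \<longleftrightarrow> w = fzero E (proj E e)"
    using fibre_eqI[OF ct(2,3) w z] triv_ops(1)[OF ct(2,3)] by metis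
  finally show ?thesis .
qed

text \<open>The hypothesis on the vertical lifts says \<open>w' = - \<i> w\<close>, so that \<open>w + \<i> w' = 2 w\<close>.\<close>

lemma fadd_fscale_ii_eq_fzero_iff:
  assumes X: "smooth_manifold X" and e: "e \<in> topspace (etop E)"
    and w: "w \<in> fibre E (proj E e)" and w': "w' \<in> fibre E (proj E e)"
    and eq: "vertical_lift X E e w' = (\<lambda>C. - vertical_lift X E e (fscale E \<i> w) C)"
  shows "fadd E w (fscale E \<i> w') = fzero E (proj E e) \<longleftrightarrow> w = fzero E (proj E e)"
proof -
  obtain c t where ct: "c \<in> charts_at X (proj E e)" "t \<in> trivs E" "proj E e \<in> fst t"
    using triv_chart_exists[OF X e] by blast
  note closed = fibre_ops[OF proj_points[OF e]]
  have "snd t w' = - snd t (fscale E \<i> w)"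
    using fun_cong[OF eq, of "triv_chart c t"] vertical_lift_chart[OF e w' ct]
      vertical_lift_chart[OF e closed(3)[OF w] ct, of \<i>] by simp
  then have "snd t (fscale E \<i> w') = - model_scale E (\<i> * \<i>) (snd t w)"
    using triv_ops(3)[OF ct(2,3)] w w' by (simp only: scale_minus_right scale_scale)
  \<comment> \<open>Here \<open>\<i> * \<i>\<close> is the real number -1, on which
    \<open>model_scale\<close> agrees with real scaling.\<close>
  also have "\<dots> = snd t w"
    using model_scale_of_real[of "-1"] by simp
  finally have "snd t (fadd E w (fscale E \<i> w')) = snd t w + snd t w"
    using triv_ops(2)[OF ct(2,3) w closed(3)[OF w', of \<i>]] by simp
  moreover have "snd t w + snd t w = 2 *\<^sub>R snd t w"
    by (simp add: scaleR_2)
  ultimately have "snd t (fadd E w (fscale E \<i> w')) = 0 \<longleftrightarrow> snd t w = 0"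
    by simp
  then show ?thesis
    using fibre_eqI[OF ct(2,3) _ closed(1)] triv_ops(1)[OF ct(2,3)] w closed(2)[OF w closed(3)[OF w', of \<i>]]
    by metis
qed

end

section \<open>The operator \<open>d''\<close>\<close>

context
  fixes X :: "('a, 'm::real_normed_vector) manifold"
    and J :: "('a, 'm) endo_field"
    and E :: "('e, 'a, 'f::real_normed_vector) vbundle"
    and \<J> :: "('e, 'm \<times> 'f) endo_field"
    and s :: "'a \<Rightarrow> 'e" and p v
  assumes acm: "almost_complex_manifold X J"
    and vb: "complex_vector_bundle X E"
    and bacs: "bundle_almost_complex_structure X J E \<J>"
    and sec: "smooth_section X E s"
    and p: "p \<in> points X" and v: "v \<in> tangent_space X p"
begin

lemma smooth_X: "smooth_manifold X" and acs_X: "almost_complex_structure X J"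
  using acm unfolding almost_complex_manifold_def by blast+

lemma acs_total: "almost_complex_structure (total_space X E) \<J>"
  and proj_holomorphic: "pseudoholomorphic (total_space X E) \<J> X J (proj E)"
  and fibre_structure: "e \<in> topspace (etop E) \<Longrightarrow> w \<in> fibre E (proj E e) \<Longrightarrow>
    \<J> e (vertical_lift X E e w) = vertical_lift X E e (fscale E \<i> w)"
  using bacs unfolding bundle_almost_complex_structure_def Let_def by blast+

lemma smooth_proj: "smooth_map (total_space X E) X (proj E)"
  using proj_holomorphic unfolding pseudoholomorphic_def by blast

lemma smooth_s: "smooth_map X (total_space X E) s" and proj_s: "q \<in> points X \<Longrightarrow> proj E (s q) = q"
  using sec unfolding smooth_section_def by blast+

lemmas smooth_T = smooth_total_space[OF vb]

lemma s_points: "s p \<in> points (total_space X E)"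
  by (rule smooth_map_points[OF smooth_s p])

lemma s_topspace: "s p \<in> topspace (etop E)"
  using s_points by (simp add: points_total_space[OF vb])

abbreviation "ds \<equiv> tangent_map X (total_space X E) s p"
abbreviation "d\<pi> \<equiv> tangent_map (total_space X E) X (proj E) (s p)"

lemma ds_tangent: "u \<in> tangent_space X p \<Longrightarrow> ds u \<in> tangent_space (total_space X E) (s p)"
  by (rule tangent_map_in_tangent_space[OF smooth_X smooth_T smooth_s p])

text \<open>The derivative of the section identity \<pi> \<circ> s = id.\<close>

lemma d\<pi>_ds: "u \<in> tangent_space X p \<Longrightarrow> d\<pi> (ds u) = u"
  by (rule tangent_map_section[OF smooth_X smooth_T smooth_s smooth_proj proj_s p])

lemma J_tangent: "J p v \<in> tangent_space X p"
  by (rule almost_complex_structureD(1)[OF acs_X p v])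

lemma \<J>_tangent:
  "u \<in> tangent_space (total_space X E) (s p) \<Longrightarrow> \<J> (s p) u \<in> tangent_space (total_space X E) (s p)"
  by (rule almost_complex_structureD(1)[OF acs_total s_points])

lemma d''_eq:
  "d'' X J E \<J> s p v = (\<lambda>c. (1/2) *\<^sub>R ds v c + (1/2) *\<^sub>R \<J> (s p) (ds (J p v)) c)"
  by (simp add: d''_def Let_def scaleR_add_right)

text \<open>Holomorphy of the projection moves \<J> past \<open>d\<pi>\<close>, so the second
  summand projects to half of \<open>J (J v) = - v\<close> and cancels the first.\<close>

lemma d''_vertical: "d'' X J E \<J> s p v \<in> vertical_space X E (s p)"
proof -
  have "d\<pi> (\<J> (s p) (ds (J p v))) = J p (d\<pi> (ds (J p v)))"
    using proj_holomorphic s_points ds_tangent[OF J_tangent] proj_s[OF p]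
    unfolding pseudoholomorphic_def by metis
  also have "\<dots> = (\<lambda>c. - v c)"
    by (simp only: d\<pi>_ds[OF J_tangent] almost_complex_structureD(4)[OF acs_X p v])
  finally have "d\<pi> (d'' X J E \<J> s p v) = (\<lambda>c. 0)"
    unfolding d''_eq
    by (simp add: tangent_map_linear_combination[OF smooth_T smooth_proj s_points ds_tangent[OF v] \<J>_tangent[OF ds_tangent[OF J_tangent]]]
        d\<pi>_ds[OF v])
  moreover have "d'' X J E \<J> s p v \<in> tangent_space (total_space X E) (s p)"
    unfolding d''_eq
    by (rule tangent_space_linear_combination[OF smooth_T ds_tangent[OF v] \<J>_tangent[OF ds_tangent[OF J_tangent]]])
  ultimately show ?thesis
    unfolding vertical_space_def by blast
qed

text \<open>\<J> squares to -1 on the second summand. The result is half the defect in the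
  Cauchy--Riemann equation at \<open>v\<close>, and up to sign the value of \<open>d''s\<close> at
  \<open>J v\<close>.\<close>

lemma \<J>_d'':
  "\<J> (s p) (d'' X J E \<J> s p v) = (\<lambda>c. (1/2) *\<^sub>R (\<J> (s p) (ds v) c - ds (J p v) c))"
proof -
  let ?T = "total_space X E" and ?w = "\<J> (s p) (ds (J p v))"
  note acs = almost_complex_structureD[OF acs_total s_points]
  have t: "ds v \<in> tangent_space ?T (s p)" "ds (J p v) \<in> tangent_space ?T (s p)" "?w \<in> tangent_space ?T (s p)"
    by (rule ds_tangent[OF v] ds_tangent[OF J_tangent] \<J>_tangent[OF ds_tangent[OF J_tangent]])+
  \<comment> \<open>Additivity of \<J> is given only for tangent vectors, so each scaled summand
    must be known to be tangent.\<close>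
  have half: "(\<lambda>c. (1/2) *\<^sub>R u c) \<in> tangent_space ?T (s p)" if "u \<in> tangent_space ?T (s p)" for u
    using tangent_space_linear_combination[OF smooth_T that that, of "1/2" 0] by simp
  have "\<J> (s p) (d'' X J E \<J> s p v) =
      (\<lambda>c. \<J> (s p) (\<lambda>c. (1/2) *\<^sub>R ds v c) c + \<J> (s p) (\<lambda>c. (1/2) *\<^sub>R ?w c) c)"
    unfolding d''_eq by (rule acs(2)[OF half[OF t(1)] half[OF t(3)]])
  also have "\<dots> = (\<lambda>c. (1/2) *\<^sub>R \<J> (s p) (ds v) c + (1/2) *\<^sub>R (- ds (J p v) c))"
    by (simp only: acs(3)[OF t(1)] acs(3)[OF t(3)] acs(4)[OF t(2)])
  finally show ?thesis
    by (simp add: scaleR_diff_right)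
qed

text \<open>Since \<open>J\<close> squares to -1, the second summand at \<open>J v\<close> is
  \<open>- \<J> (ds v)\<close> before halving. This antilinearity is what makes \<open>d''s\<close>
  of type (0,1).\<close>

lemma d''_J: "d'' X J E \<J> s p (J p v) = (\<lambda>c. - \<J> (s p) (d'' X J E \<J> s p v) c)"
proof -
  have "ds (J p (J p v)) = (\<lambda>c. - ds v c)"
    by (simp only: almost_complex_structureD(4)[OF acs_X p v] tangent_map_uminus[OF smooth_X smooth_s p v])
  then have "\<J> (s p) (ds (J p (J p v))) = (\<lambda>c. - \<J> (s p) (ds v) c)"
    by (simp only: almost_complex_structure_uminus[OF acs_total s_points ds_tangent[OF v]])
  then show ?thesis
    unfolding \<J>_d'' by (simp add: d''_def Let_def scaleR_diff_right)
qed

text \<open>Because \<J> squares to -1 it is injective on tangent vectors, so \<open>d''s v\<close>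
  can be tested after applying \<J>.\<close>

lemma d''_eq_0_iff: "d'' X J E \<J> s p v = (\<lambda>c. 0) \<longleftrightarrow> ds (J p v) = \<J> (s p) (ds v)"
proof -
  let ?D = "d'' X J E \<J> s p v"
  have D: "?D \<in> tangent_space (total_space X E) (s p)"
    using d''_vertical unfolding vertical_space_def by blast
  have "ds (J p v) = \<J> (s p) (ds v) \<longleftrightarrow> \<J> (s p) ?D = (\<lambda>c. 0)"
    unfolding \<J>_d'' by (auto simp: fun_eq_iff)
  moreover have "\<J> (s p) (\<lambda>c. 0) = (\<lambda>c. 0)"
    using almost_complex_structureD(3)[OF acs_total s_points D, of 0] by simp
  moreover have "?D = (\<lambda>c. 0)" if "\<J> (s p) ?D = (\<lambda>c. 0)"
    using almost_complex_structureD(4)[OF acs_total s_points D] that \<open>\<J> (s p) (\<lambda>c. 0) = (\<lambda>c. 0)\<close>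
    by (simp add: fun_eq_iff)
  ultimately show ?thesis
    by metis
qed

end

section \<open>Vanishing of the operator and the Cauchy--Riemann equation\<close>

lemma dbar_eq_fzero_iff:
  fixes X :: "('a, 'm::real_normed_vector) manifold"
    and E :: "('e, 'a, 'f::real_normed_vector) vbundle"
  assumes hyps: "almost_complex_manifold X J" "complex_vector_bundle X E"
      "bundle_almost_complex_structure X J E \<J>" "smooth_section X E s" "p \<in> points X"
    and v: "v \<in> tangent_space X p"
  shows "dbar X J E \<J> s p (v, J p v) = fzero E p \<longleftrightarrow>
    tangent_map X (total_space X E) s p (J p v) = \<J> (s p) (tangent_map X (total_space X E) s p v)"
proof -
  let ?D = "d'' X J E \<J> s p" and ?\<alpha> = "\<lambda>v. vertical_part X E (s p) (d'' X J E \<J> s p v)"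
  have X: "smooth_manifold X" and J: "almost_complex_structure X J"
    by (rule smooth_X[OF hyps v] acs_X[OF hyps v])+
  note e = s_topspace[OF hyps v]
  have ps: "proj E (s p) = p"
    by (rule proj_s[OF hyps v hyps(5)])
  note vp = vertical_part[OF hyps(2) X smooth_proj[OF hyps v] e]
  note J_tangent = J_tangent[OF hyps v]
  \<comment> \<open>The results for a fixed tangent vector are used twice, at \<open>v\<close> and
    at \<open>J p v\<close>.\<close>
  note \<alpha>v = vp[OF d''_vertical[OF hyps v]] and \<alpha>J_tangent = vp[OF d''_vertical[OF hyps J_tangent]]
  have "vertical_lift X E (s p) (?\<alpha> (J p v)) = (\<lambda>c. - \<J> (s p) (vertical_lift X E (s p) (?\<alpha> v)) c)"
    unfolding \<alpha>v(2) \<alpha>J_tangent(2) by (rule d''_J[OF hyps v])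
  \<comment> \<open>On vertical lifts \<J> is multiplication by \<open>\<i>\<close> in the fibre,
    which turns antilinearity of \<open>d''s\<close> into antilinearity of \<alpha>.\<close>
  then have lift: "vertical_lift X E (s p) (?\<alpha> (J p v)) =
      (\<lambda>c. - vertical_lift X E (s p) (fscale E \<i> (?\<alpha> v)) c)"
    by (simp only: fibre_structure[OF hyps v e \<alpha>v(1)])
  have "(v, J p v) \<in> tangent01 X J p"
    using tangent01_iff[OF J hyps(5)] v by blast
  then have "dbar X J E \<J> s p (v, J p v) = fadd E (?\<alpha> v) (fscale E \<i> (?\<alpha> (J p v)))"
    by (simp add: dbar_def)
  then have "dbar X J E \<J> s p (v, J p v) = fzero E p \<longleftrightarrow> ?\<alpha> v = fzero E p"
    using fadd_fscale_ii_eq_fzero_iff[OF hyps(2) X e \<alpha>v(1) \<alpha>J_tangent(1) lift] by (simp only: ps)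
  also have "\<dots> \<longleftrightarrow> ?D v = (\<lambda>c. 0)"
    using vertical_lift_eq_0_iff[OF hyps(2) X e \<alpha>v(1)] by (simp only: ps \<alpha>v(2))
  also have "\<dots> \<longleftrightarrow> tangent_map X (total_space X E) s p (J p v) =
      \<J> (s p) (tangent_map X (total_space X E) s p v)"
    by (rule d''_eq_0_iff[OF hyps v])
  finally show ?thesis .
qed

theorem corollary4p2:
  fixes X :: "('a, 'm::real_normed_vector) manifold"
    and J :: "('a, 'm) endo_field"
    and E :: "('e, 'a, 'f::real_normed_vector) vbundle"
    and \<J> :: "('e, 'm \<times> 'f) endo_field"
    and s :: "'a \<Rightarrow> 'e"
  assumes "almost_complex_manifold X J"
    and "complex_vector_bundle X E"
    and "bundle_almost_complex_structure X J E \<J>"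
    and "smooth_section X E s"
  shows "vanishes01 X J E (dbar X J E \<J> s) \<longleftrightarrow>
         pseudoholomorphic X J (total_space X E) \<J> s"
proof -
  have J: "almost_complex_structure X J"
    using assms(1) unfolding almost_complex_manifold_def by blast
  have s: "smooth_map X (total_space X E) s"
    using assms(4) unfolding smooth_section_def by blast
  \<comment> \<open>Quantification over (0,1)-vectors becomes quantification over real tangent
    vectors, since each has the form \<open>v + \<i> J v\<close>.\<close>
  have "vanishes01 X J E (dbar X J E \<J> s) \<longleftrightarrow>
      (\<forall>p\<in>points X. \<forall>v\<in>tangent_space X p. dbar X J E \<J> s p (v, J p v) = fzero E p)"
    unfolding vanishes01_def
  proof (rule ball_cong[OF refl])
    fix p
    assume "p \<in> points X"
    then have "tangent01 X J p = (\<lambda>v. (v, J p v)) ` tangent_space X p"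
      using tangent01_iff[OF J] by fast
    then show "(\<forall>\<zeta>\<in>tangent01 X J p. dbar X J E \<J> s p \<zeta> = fzero E p) \<longleftrightarrow>
        (\<forall>v\<in>tangent_space X p. dbar X J E \<J> s p (v, J p v) = fzero E p)"
      by (simp only: ball_simps)
  qed
  also have "\<dots> \<longleftrightarrow> (\<forall>p\<in>points X. \<forall>v\<in>tangent_space X p.
      tangent_map X (total_space X E) s p (J p v) = \<J> (s p) (tangent_map X (total_space X E) s p v))"
    by (intro ball_cong refl dbar_eq_fzero_iff[OF assms])
  \<comment> \<open>Holomorphy also demands smoothness of the map, which the section has by
    hypothesis.\<close>
  also have "\<dots> \<longleftrightarrow> pseudoholomorphic X J (total_space X E) \<J> s"
    using s by (simp only: pseudoholomorphic_def simp_thms)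
  finally show ?thesis .
qed

end
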